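(* For all $x,y\in(0,1]$, $\phi(x,y)=\phi(y,x)$.
   Context: All graphs are finite, with no loops or multiple edges. $(0,1]$ is the set of reals $t$ with $0<t\le 1$. A tripartition of a graph $G$ is a partition $(A,B,C)$ of $V(G)$ into three nonempty stable (independent) sets. For $x,y\in(0,1]$, $G$ is $(x,y)$-constrained via a tripartition $(A,B,C)$ if every vertex in $A$ has at least $x|B|$ neighbours in $B$, every vertex in $B$ has at least $y|C|$ neighbours in $C$, and there are no edges between $A$ and $C$. $N^2(v)$ is the set of vertices at distance exactly two from $v$, and $N^2_A(v)=N^2(v)\cap A$. $\phi(x,y)$ is the maximum $z\in(0,1]$ (it exists) such that for every graph $G$ that is $(x,y)$-constrained via some $(A,B,C)$, there is a vertex $v\in C$ with $|N^2_A(v)|\ge z|A|$. *)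

theory Defs
  imports "Graph_Theory.Pair_Digraph" "Graph_Theory.Shortest_Path"
begin

text \<open>
  A finite graph without loops or multiple edges is a \<^locale>\<open>pair_graph\<close>: a finite vertex set
  with a symmetric irreflexive arc relation, each edge being represented by its two arcs.
\<close>

definition neighbours :: "'a pair_pre_digraph \<Rightarrow> 'a \<Rightarrow> 'a set" where
  "neighbours G v = {u. (v, u) \<in> parcs G}"

definition stable :: "'a pair_pre_digraph \<Rightarrow> 'a set \<Rightarrow> bool" where
  "stable G S \<longleftrightarrow> S \<subseteq> pverts G \<and> (\<forall>u\<in>S. \<forall>v\<in>S. (u, v) \<notin> parcs G)"

definition tripartition :: "'a pair_pre_digraph \<Rightarrow> 'a set \<Rightarrow> 'a set \<Rightarrow> 'a set \<Rightarrow> bool" where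
  "tripartition G A B C \<longleftrightarrow>
     A \<union> B \<union> C = pverts G \<and> A \<inter> B = {} \<and> A \<inter> C = {} \<and> B \<inter> C = {} \<and>
     A \<noteq> {} \<and> B \<noteq> {} \<and> C \<noteq> {} \<and> stable G A \<and> stable G B \<and> stable G C"

definition constrained ::
    "real \<Rightarrow> real \<Rightarrow> 'a pair_pre_digraph \<Rightarrow> 'a set \<Rightarrow> 'a set \<Rightarrow> 'a set \<Rightarrow> bool" where
  "constrained x y G A B C \<longleftrightarrow>
     tripartition G A B C \<and>
     (\<forall>v\<in>A. real (card (neighbours G v \<inter> B)) \<ge> x * real (card B)) \<and>
     (\<forall>v\<in>B. real (card (neighbours G v \<inter> C)) \<ge> y * real (card C)) \<and>
     (\<forall>a\<in>A. \<forall>c\<in>C. (a, c) \<notin> parcs G)"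

text \<open>
  Graph distance is the shortest-walk cost \<open>\<mu>\<close> for unit arc weights. The constant is defined
  inside \<^locale>\<open>wf_digraph\<close>, so it is meaningful only for well-formed \<open>G\<close>; it is
  used below only for a \<^locale>\<open>pair_graph\<close>.
\<close>

definition graph_dist :: "'a pair_pre_digraph \<Rightarrow> 'a \<Rightarrow> 'a \<Rightarrow> ereal" where
  "graph_dist G u v = wf_digraph.\<mu> (with_proj G) (\<lambda>_. 1) u v"

definition second_neighbours :: "'a pair_pre_digraph \<Rightarrow> 'a \<Rightarrow> 'a set" where
  "second_neighbours G v = {u \<in> pverts G. graph_dist G v u = 2}"

definition reaches_fraction ::
    "real \<Rightarrow> 'a pair_pre_digraph \<Rightarrow> 'a set \<Rightarrow> 'a set \<Rightarrow> bool" where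
  "reaches_fraction z G A C \<longleftrightarrow>
     (\<exists>v\<in>C. real (card (second_neighbours G v \<inter> A)) \<ge> z * real (card A))"

text \<open>
  Every finite graph is isomorphic to one with vertices in \<^typ>\<open>nat\<close>, so it suffices to let \<open>G\<close>
  range over these. Lemma \<open>phi_props\<close> below shows that the maximum defining \<open>\<phi>\<close> exists, and
  \<open>phi_admissible_any\<close> that its bound holds over every vertex type.
\<close>

definition admissible :: "real \<Rightarrow> real \<Rightarrow> real \<Rightarrow> bool" where
  "admissible x y z \<longleftrightarrow>
     (\<forall>(G :: nat pair_pre_digraph) A B C.
        pair_graph G \<longrightarrow> constrained x y G A B C \<longrightarrow> reaches_fraction z G A C)"

definition phi :: "real \<Rightarrow> real \<Rightarrow> real" where
  "phi x y = (GREATEST z. z \<in> {0<..1} \<and> admissible x y z)"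

lemma second_neighbours_iff:
  assumes "pair_graph G" "v \<in> pverts G"
  shows "u \<in> second_neighbours G v \<longleftrightarrow>
    u \<noteq> v \<and> (v, u) \<notin> parcs G \<and> (\<exists>w. (v, w) \<in> parcs G \<and> (w, u) \<in> parcs G)"
proof -
  interpret pair_graph G by fact
  have cost: "awalk_cost (\<lambda>_. 1) p = real (length p)" for p :: "('a \<times> 'a) list"
    by (induct p) auto
  have gd: "graph_dist G v u = \<mu> (\<lambda>_. 1) v u" by (simp add: graph_dist_def)
  have upper: "graph_dist G v u \<le> ereal (real (length p))" if "awalk v p u" for p
    using min_cost_le_walk_cost[OF that, of "\<lambda>_. 1"] by (simp add: gd cost)
  have attain: "\<exists>p. awalk v p u \<and> graph_dist G v u = ereal (real (length p))"
    if fin: "graph_dist G v u = 2"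
  proof -
    have "\<mu> (\<lambda>_. 1) v u < \<infinity>" using fin by (simp add: gd)
    note r = this[unfolded \<mu>_reach_conv]
    have "\<exists>p. apath v p u \<and> \<mu> (\<lambda>_. 1) v u = awalk_cost (\<lambda>_. 1) p"
      by (rule no_neg_cyc_reach_imp_path[OF r]) (auto simp: cost)
    then show ?thesis by (auto simp: gd cost apath_def)
  qed
  show ?thesis
  proof
    assume "u \<in> second_neighbours G v"
    then have d: "graph_dist G v u = 2" by (simp add: second_neighbours_def)
    then obtain p where p: "awalk v p u" "real (length p) = 2"
      using attain[OF d] by (auto simp: numeral_eq_ereal)
    then have "length p = 2" by linarith
    then obtain e f where "p = [e, f]" by (auto simp: length_Suc_conv numeral_2_eq_2)
    with p have ef: "fst e = v" "snd e = fst f" "snd f = u" "e \<in> parcs G" "f \<in> parcs G"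
      by (auto simp: awalk_def)
    have "u \<noteq> v"
    proof
      assume "u = v"
      then have "awalk v [] u" using assms by (auto simp: awalk_def)
      from upper[OF this] d show False by simp
    qed
    moreover have "(v, u) \<notin> parcs G"
    proof
      assume "(v, u) \<in> parcs G"
      then have "awalk v [(v,u)] u" using assms by (auto simp: awalk_def)
      from upper[OF this] d show False by (simp add: numeral_eq_ereal one_ereal_def)
    qed
    moreover have "(v, snd e) \<in> parcs G" "(snd e, u) \<in> parcs G"
      using ef by (metis prod.collapse)+
    ultimately show "u \<noteq> v \<and> (v, u) \<notin> parcs G \<and> (\<exists>w. (v, w) \<in> parcs G \<and> (w, u) \<in> parcs G)"
      by blast
  next
    assume "u \<noteq> v \<and> (v, u) \<notin> parcs G \<and> (\<exists>w. (v, w) \<in> parcs G \<and> (w, u) \<in> parcs G)"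
    then obtain w where w: "u \<noteq> v" "(v, u) \<notin> parcs G" "(v, w) \<in> parcs G" "(w, u) \<in> parcs G"
      by blast
    have "awalk v [(v,w),(w,u)] u" using w assms by (auto simp: awalk_def)
    from upper[OF this] have le: "graph_dist G v u \<le> 2" by (simp add: numeral_eq_ereal)
    have "ereal 2 \<le> ereal (awalk_cost (\<lambda>_. 1) p)" if p: "awalk v p u" for p
    proof -
      have "length p \<noteq> 0" using p w by (auto simp: awalk_def)
      moreover have "length p \<noteq> 1"
      proof
        assume "length p = 1"
        then obtain e where "p = [e]" by (auto simp: length_Suc_conv)
        with p w show False by (cases e) (auto simp: awalk_def)
      qed
      ultimately have "length p \<ge> 2" by linarith
      then show ?thesis by (simp add: cost)
    qed
    then have "ereal 2 \<le> graph_dist G v u"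
      unfolding gd \<mu>_def by (intro INF_greatest) auto
    with le have "graph_dist G v u = 2" by (simp add: numeral_eq_ereal)
    then show "u \<in> second_neighbours G v"
      using w in_arcsD2 by (auto simp: second_neighbours_def)
  qed
qed

lemma reaches_fraction_y:
  assumes G: "pair_graph G" and c: "constrained x y G A B C" and x: "0 < x"
  shows "reaches_fraction y G A C"
proof (rule ccontr)
  interpret pair_graph G by fact
  assume n: "\<not> reaches_fraction y G A C"
  have tri: "tripartition G A B C" using c by (simp add: constrained_def)
  have sub: "A \<subseteq> pverts G" "B \<subseteq> pverts G" "C \<subseteq> pverts G"
    using tri by (auto simp: tripartition_def)
  have fin: "finite A" "finite B" "finite C"
    using sub pair_finite_verts finite_subset by blast+
  have ne: "A \<noteq> {}" "B \<noteq> {}" "C \<noteq> {}" "A \<inter> C = {}" using tri by (auto simp: tripartition_def)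
  have symm: "(u, v) \<in> parcs G \<Longrightarrow> (v, u) \<in> parcs G" for u v
    using arcs_ends_symmetric[OF pair_sym_arcs, of u v] by simp
  let ?N = "second_neighbours G"
  have a: "y * real (card C) \<le> real (card {v\<in>C. a \<in> ?N v})" if "a \<in> A" for a
  proof -
    have "0 < x * real (card B)" using x ne fin by (simp add: card_gt_0_iff)
    also have "\<dots> \<le> real (card (neighbours G a \<inter> B))" using c that by (auto simp: constrained_def)
    finally have "neighbours G a \<inter> B \<noteq> {}" by auto
    then obtain b where b: "b \<in> B" "(a, b) \<in> parcs G" by (auto simp: neighbours_def)
    have "neighbours G b \<inter> C \<subseteq> {v\<in>C. a \<in> ?N v}"
    proof
      fix v assume "v \<in> neighbours G b \<inter> C"
      then have v: "(b, v) \<in> parcs G" "v \<in> C" by (auto simp: neighbours_def)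
      have vG: "v \<in> pverts G" using v sub by auto
      have "(v, a) \<notin> parcs G" using c v that symm[of v a] by (auto simp: constrained_def)
      moreover have "a \<noteq> v" using ne v that by auto
      ultimately show "v \<in> {v\<in>C. a \<in> ?N v}"
        using v symm[OF v(1)] symm[OF b(2)] vG by (auto simp: second_neighbours_iff[OF G vG])
    qed
    then have "card (neighbours G b \<inter> C) \<le> card {v\<in>C. a \<in> ?N v}"
      using fin by (intro card_mono) auto
    moreover have "y * real (card C) \<le> real (card (neighbours G b \<inter> C))"
      using c b by (auto simp: constrained_def)
    ultimately show ?thesis by linarith
  qed
  have "(\<Sum>v\<in>C. real (card (?N v \<inter> A))) < (\<Sum>v\<in>C. y * real (card A))"
    using n ne fin by (intro sum_strict_mono) (auto simp: reaches_fraction_def not_le)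
  also have "\<dots> = (\<Sum>a\<in>A. y * real (card C))" by simp
  also have "\<dots> \<le> (\<Sum>a\<in>A. real (card {v\<in>C. a \<in> ?N v}))" by (intro sum_mono a)
  also have "\<dots> = (\<Sum>v\<in>C. real (card {a\<in>A. a \<in> ?N v}))"
    using sum_multicount_gen[OF fin(3) fin(1), of "\<lambda>v a. a \<in> ?N v" "\<lambda>a. card {v\<in>C. a \<in> ?N v}"]
    by (simp flip: of_nat_sum)
  also have "(\<Sum>v\<in>C. real (card {a\<in>A. a \<in> ?N v})) = (\<Sum>v\<in>C. real (card (?N v \<inter> A)))"
    by (intro sum.cong refl) (simp add: Int_def conj_commute)
  finally show False by simp
qed

lemma phi_props:
  assumes x: "x \<in> {0<..1}" and y: "y \<in> {0<..1}"
  shows "phi x y \<in> {0<..1}" "admissible x y (phi x y)"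
    and "\<And>z. z \<in> {0<..1} \<Longrightarrow> admissible x y z \<Longrightarrow> z \<le> phi x y"
proof -
  define S where "S = {z. z \<in> {0<..1} \<and> admissible x y z}"
  have yS: "y \<in> S" using x y reaches_fraction_y by (auto simp: S_def admissible_def)
  have bdd: "bdd_above S" by (rule bdd_aboveI[of _ 1]) (auto simp: S_def)
  define s where "s = Sup S"
  have up: "z \<le> s" if "z \<in> S" for z using cSup_upper[OF that bdd] by (simp add: s_def)
  have "S \<noteq> {}" using yS by blast
  then have "s \<le> 1" unfolding s_def by (rule cSup_least) (simp add: S_def)
  with up[OF yS] y have s1: "s \<in> {0<..1}" by simp
  have sa: "admissible x y s"
    unfolding admissible_def
  proof (intro allI impI, rule ccontr)
    fix G :: "nat pair_pre_digraph" and A B C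
    assume G: "pair_graph G" and c: "constrained x y G A B C" and n: "\<not> reaches_fraction s G A C"
    interpret pair_graph G by fact
    have tri: "tripartition G A B C" using c by (simp add: constrained_def)
    have sub: "A \<subseteq> pverts G" "C \<subseteq> pverts G" using tri by (auto simp: tripartition_def)
    have fin: "finite A" "finite C" using sub pair_finite_verts finite_subset by blast+
    have ne: "A \<noteq> {}" "C \<noteq> {}" using tri by (auto simp: tripartition_def)
    have pos: "0 < real (card A)" using ne fin by (simp add: card_gt_0_iff)
    let ?r = "\<lambda>v. real (card (second_neighbours G v \<inter> A)) / real (card A)"
    let ?m = "Max (?r ` C)"
    have "?m \<in> ?r ` C" using fin ne by (intro Max_in) auto
    then obtain v where v: "v \<in> C" "?m = ?r v" by blast
    have "real (card (second_neighbours G v \<inter> A)) < s * real (card A)"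
      using n v(1) by (auto simp: reaches_fraction_def not_le)
    then have "?m < s" using pos unfolding v(2) by (simp add: pos_divide_less_eq)
    moreover have "s \<le> ?m" unfolding s_def
    proof (rule cSup_least)
      show "S \<noteq> {}" using yS by auto
      fix z assume "z \<in> S"
      then have "reaches_fraction z G A C" using G c by (auto simp: S_def admissible_def)
      then obtain v where v: "v \<in> C" "z \<le> ?r v"
        using pos by (auto simp: reaches_fraction_def pos_le_divide_eq)
      moreover have "?r v \<le> ?m" using v fin by (intro Max_ge) auto
      ultimately show "z \<le> ?m" by linarith
    qed
    ultimately show False by simp
  qed
  have eq: "phi x y = s" unfolding phi_def
    by (rule Greatest_equality) (use s1 sa up in \<open>auto simp: S_def\<close>)
  show "phi x y \<in> {0<..1}" "admissible x y (phi x y)" using s1 sa eq by auto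
  show "z \<le> phi x y" if "z \<in> {0<..1}" "admissible x y z" for z
    using up that eq by (auto simp: S_def)
qed

lemma admissible_any:
  fixes G :: "'a pair_pre_digraph"
  assumes adm: "admissible x y z" and G: "pair_graph G" and c: "constrained x y G A B C"
  shows "reaches_fraction z G A C"
proof -
  interpret pair_graph G by fact
  obtain f :: "'a \<Rightarrow> nat" where f: "inj_on f (pverts G)"
    using finite_imp_inj_to_nat_seg[OF pair_finite_verts] by metis
  define H where "H = \<lparr>pverts = f ` pverts G, parcs = map_prod f f ` parcs G\<rparr>"
  have symm: "(u, v) \<in> parcs G \<Longrightarrow> (v, u) \<in> parcs G" for u v
    using arcs_ends_symmetric[OF pair_sym_arcs, of u v] by simp
  have noloop: "(u, u) \<notin> parcs G" for u using pair_no_loops by force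
  have arc: "(f u, f v) \<in> parcs H \<longleftrightarrow> (u, v) \<in> parcs G" if "u \<in> pverts G" "v \<in> pverts G" for u v
  proof
    assume "(f u, f v) \<in> parcs H"
    then obtain u' v' where "(u', v') \<in> parcs G" "f u' = f u" "f v' = f v"
      by (auto simp: H_def)
    then show "(u, v) \<in> parcs G"
      using that inj_onD[OF f] in_arcsD1 in_arcsD2 by metis
  qed (force simp: H_def)
  have H: "pair_graph H"
  proof (unfold_locales)
    have "sym (parcs H)"
    proof (rule symI)
      fix a b assume "(a, b) \<in> parcs H"
      then obtain u v where "(u, v) \<in> parcs G" "a = f u" "b = f v" by (auto simp: H_def)
      then show "(b, a) \<in> parcs H" using symm[of u v] by (force simp: H_def)
    qed
    then show "symmetric (with_proj H)" by (simp add: symmetric_def)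
    show "fst e \<noteq> snd e" if "e \<in> parcs H" for e
    proof -
      obtain u v where uv: "(u, v) \<in> parcs G" "e = (f u, f v)" using \<open>e \<in> parcs H\<close> by (auto simp: H_def)
      then have "u \<noteq> v" using noloop by auto
      with uv show ?thesis using inj_onD[OF f, of u v] in_arcsD1[OF uv(1)] in_arcsD2[OF uv(1)] by auto
    qed
  qed (auto simp: H_def intro: in_arcsD1 in_arcsD2 finite_imageI pair_finite_verts pair_finite_arcs)
  have tri: "tripartition G A B C" using c by (simp add: constrained_def)
  have sub: "A \<subseteq> pverts G" "B \<subseteq> pverts G" "C \<subseteq> pverts G"
    using tri by (auto simp: tripartition_def)
  have im: "card (f ` S) = card S" if "S \<subseteq> pverts G" for S
    using card_image inj_on_subset[OF f that] by blast
  have nb: "neighbours H (f v) \<inter> f ` S = f ` (neighbours G v \<inter> S)"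
    if "v \<in> pverts G" "S \<subseteq> pverts G" for v S
    using that arc by (auto simp: neighbours_def)
  have nbc: "card (neighbours H (f v) \<inter> f ` S) = card (neighbours G v \<inter> S)"
    if "v \<in> pverts G" "S \<subseteq> pverts G" for v S
    using nb[OF that] im[of "neighbours G v \<inter> S"] that by auto
  have disj: "f ` S \<inter> f ` T = {}" if "S \<inter> T = {}" "S \<subseteq> pverts G" "T \<subseteq> pverts G" for S T
    using inj_on_image_Int[OF f, of S T] that by simp
  have st: "stable H (f ` S)" if "stable G S" for S
    using that arc by (auto simp: stable_def H_def subset_iff)
  have "tripartition H (f ` A) (f ` B) (f ` C)"
    using tri st disj sub unfolding tripartition_def by (auto simp: H_def)
  then have "constrained x y H (f ` A) (f ` B) (f ` C)"
    using c sub by (auto simp: constrained_def im nbc subset_iff arc)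
  then have "reaches_fraction z H (f ` A) (f ` C)" using adm H by (auto simp: admissible_def)
  then obtain v where v: "v \<in> C"
    "z * real (card A) \<le> real (card (second_neighbours H (f v) \<inter> f ` A))"
    using sub by (auto simp: reaches_fraction_def im)
  have vG: "v \<in> pverts G" using v sub by auto
  then have vH: "f v \<in> pverts H" by (simp add: H_def)
  have mid: "\<exists>w\<in>pverts G. k = f w" if "(f v, k) \<in> parcs H" for k
    using that in_arcsD2 by (auto simp: H_def)
  have sn: "f u \<in> second_neighbours H (f v) \<longleftrightarrow> u \<in> second_neighbours G v" if "u \<in> pverts G" for u
  proof -
    have "(\<exists>k. (f v, k) \<in> parcs H \<and> (k, f u) \<in> parcs H) \<longleftrightarrow>
          (\<exists>w. (v, w) \<in> parcs G \<and> (w, u) \<in> parcs G)"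
      using mid arc vG that by (metis in_arcsD2)
    moreover have "f u = f v \<longleftrightarrow> u = v" using inj_onD[OF f] vG that by metis
    ultimately show ?thesis
      unfolding second_neighbours_iff[OF H vH] second_neighbours_iff[OF G vG]
      using arc[OF vG that] by simp
  qed
  have "second_neighbours H (f v) \<inter> f ` A = f ` (second_neighbours G v \<inter> A)"
    using sn sub by auto
  then have "card (second_neighbours H (f v) \<inter> f ` A) = card (second_neighbours G v \<inter> A)"
    using im[of "second_neighbours G v \<inter> A"] sub by auto
  then show ?thesis using v by (auto simp: reaches_fraction_def)
qed

lemma phi_admissible_any:
  assumes "x \<in> {0<..1}" "y \<in> {0<..1}" "pair_graph G" "constrained x y G A B C"
  shows "reaches_fraction (phi x y) G A C"
  using assms admissible_any phi_props(2) by blast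

end

(* Let G be (x,y)-constrained via (A,B,C), and suppose that every c in C has fewer than z|A| second
   neighbours in A. Averaging shows that under any weights on A some b in B sees at least an
   x-fraction of A, under any weights on B some c in C sees at least a y-fraction of B, and under any
   weights on C some a in A has less than a z-fraction of C among its second neighbours. As in a Nash
   equilibrium of a three-player game, there are weights for which these three statements hold for
   every vertex of positive weight. The weights can be taken to be integers, and replacing each vertex
   by as many copies as its weight gives a graph that is (y,x)-constrained via (C,B,A) and shows that
   z > phi y x. *)
theory Submission
  imports Defs "HOL-Analysis.Brouwer_Fixpoint" "HOL-Analysis.Kronecker_Approximation_Theorem"
begin

section \<open>Complementary weights: real approximation, then integers\<close>

(* Kuhn's lemma on the grid {0..p}^n: a coordinate is labelled 0 when its slack at the grid point is
   at least about zero, so that it wants to increase. A coordinate with nonnegative slack, which the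
   column condition provides in each class, is thus driven to its maximum. *)
lemma approx_complementary_weights:
  fixes M :: "nat \<Rightarrow> nat \<Rightarrow> real" and e :: real
  assumes e: "0 < e"
    and cls: "\<And>P. P \<in> \<P> \<Longrightarrow> P \<noteq> {} \<and> P \<subseteq> {..<n}"
    and col: "\<And>P j. P \<in> \<P> \<Longrightarrow> j < n \<Longrightarrow> 0 \<le> (\<Sum>i\<in>P. M i j)"
  obtains v :: "nat \<Rightarrow> real"
    where "\<And>i. 0 \<le> v i"
      and "\<And>i. i < n \<Longrightarrow> v i \<noteq> 0 \<Longrightarrow> - e \<le> (\<Sum>j<n. M i j * v j)"
      and "\<And>P. P \<in> \<P> \<Longrightarrow> \<exists>i\<in>P. 1/2 \<le> v i"
proof -
  define F where "F = (\<lambda>r::nat\<Rightarrow>nat. \<lambda>i. \<Sum>j<n. M i j * real (r j))"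
  define L where "L = 1 + (\<Sum>i<n. \<Sum>j<n. \<bar>M i j\<bar>)"
  have L: "0 < L" unfolding L_def by (intro add_pos_nonneg sum_nonneg) auto
  have row: "(\<Sum>j<n. \<bar>M i j\<bar>) \<le> L" if "i < n" for i
    using member_le_sum[of i "{..<n}" "\<lambda>i. \<Sum>j<n. \<bar>M i j\<bar>"] that
    by (auto simp: L_def sum_nonneg)
  obtain p0 :: nat where "3 * L / e < real p0" using reals_Archimedean2 by blast
  \<comment> \<open>Dividing by \<open>p\<close> later has to shrink a slack error of
    \<open>3 * L\<close> to \<open>e\<close>. The summand 2 ensures that a coordinate equal to
    \<open>p - 1\<close> becomes a weight of at least 1/2.\<close>
  define p where "p = p0 + 2"
  have p: "2 \<le> p" "3 * L / e < real p" using \<open>3 * L / e < real p0\<close> by (auto simp: p_def)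
  \<comment> \<open>The clauses for 0 and \<open>p\<close> are the boundary conditions of Kuhn's
    lemma. Since \<open>F\<close> changes by at most \<open>L\<close> from the lowest corner of a
    unit cube to any other, the threshold \<open>- 2 * L\<close> has two effects: a nonnegative
    slack at the lowest corner allows label 1 only on the face \<open>p\<close>, and a label 0 off
    the face 0 puts that slack above \<open>- 3 * L\<close>.\<close>
  define label where
    "label = (\<lambda>r i. if r i = 0 then 0 else if r i = p \<or> F r i + 2 * L \<le> 0 then 1 else 0::nat)"
  obtain q where q: "\<forall>i<n. q i < p"
    and rs: "\<forall>i<n. \<exists>r s. (\<forall>j<n. q j \<le> r j \<and> r j \<le> q j + 1) \<and>
           (\<forall>j<n. q j \<le> s j \<and> s j \<le> q j + 1) \<and> label r i \<noteq> label s i"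
    by (rule kuhn_lemma[of p n label]) (use p in \<open>auto simp: label_def\<close>)
  have near: "\<bar>F r i - F q i\<bar> \<le> L" if "i < n" "\<forall>j<n. q j \<le> r j \<and> r j \<le> q j + 1" for r i
  proof -
    have "\<bar>F r i - F q i\<bar> = \<bar>\<Sum>j<n. M i j * (real (r j) - real (q j))\<bar>"
      by (simp add: F_def sum_subtractf right_diff_distrib)
    also have "\<dots> \<le> (\<Sum>j<n. \<bar>M i j * (real (r j) - real (q j))\<bar>)" by (rule sum_abs)
    also have "\<dots> \<le> (\<Sum>j<n. \<bar>M i j\<bar>)"
    proof (rule sum_mono)
      fix j assume "j \<in> {..<n}"
      then have "\<bar>real (r j) - real (q j)\<bar> \<le> 1" using that(2) by force
      then show "\<bar>M i j * (real (r j) - real (q j))\<bar> \<le> \<bar>M i j\<bar>"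
        by (simp add: abs_mult mult_left_le)
    qed
    finally show ?thesis using row[OF that(1)] by linarith
  qed
  have labels: "\<exists>r s. (\<forall>j<n. q j \<le> r j \<and> r j \<le> q j + 1) \<and>
      (\<forall>j<n. q j \<le> s j \<and> s j \<le> q j + 1) \<and> label r i = 0 \<and> label s i = 1" if "i < n" for i
  proof -
    from rs that obtain r s where *: "\<forall>j<n. q j \<le> r j \<and> r j \<le> q j + 1"
      "\<forall>j<n. q j \<le> s j \<and> s j \<le> q j + 1" "label r i \<noteq> label s i" by blast
    moreover have "label r i = 0 \<or> label r i = 1" for r by (simp add: label_def)
    ultimately have "label r i = 0 \<and> label s i = 1 \<or> label s i = 0 \<and> label r i = 1"
      by metis
    with * show ?thesis by blast
  qed
  have up: "- 3 * L \<le> F q i" if i: "i < n" and "q i \<noteq> 0" for i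
  proof -
    obtain r where r: "\<forall>j<n. q j \<le> r j \<and> r j \<le> q j + 1" "label r i = 0"
      using labels[OF i] by blast
    then have "r i \<noteq> 0" using i that(2) by force
    with r(2) have "- 2 * L < F r i" by (auto simp: label_def split: if_splits)
    with near[OF i r(1)] show ?thesis by linarith
  qed
  have down: "q i + 1 = p" if i: "i < n" and "0 \<le> F q i" for i
  proof -
    obtain s where s: "\<forall>j<n. q j \<le> s j \<and> s j \<le> q j + 1" "label s i = 1"
      using labels[OF i] by blast
    \<comment> \<open>The slack clause cannot have produced the label 1, so the corner
      \<open>s\<close> lies on the upper face.\<close>
    have "0 < F s i + 2 * L" using near[OF i s(1)] L that(2) by linarith
    with s(2) have "s i = p" by (auto simp: label_def split: if_splits)
    with s(1) i q show ?thesis by force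
  qed
  show thesis
  proof (rule that[of "\<lambda>i. real (q i) / real p"])
    show "0 \<le> real (q i) / real p" for i by simp
    have scale: "(\<Sum>j<n. M i j * (real (q j) / real p)) = F q i / real p" for i
      by (simp add: F_def sum_divide_distrib)
    show "- e \<le> (\<Sum>j<n. M i j * (real (q j) / real p))" if "i < n" "real (q i) / real p \<noteq> 0" for i
    proof -
      have "- e * real p \<le> F q i"
        using up[of i] that p e by (auto simp: field_simps)
      then show ?thesis unfolding scale using p by (simp add: pos_le_divide_eq)
    qed
    fix P assume P: "P \<in> \<P>"
    have "(\<Sum>i\<in>P. F q i) = (\<Sum>j<n. (\<Sum>i\<in>P. M i j) * real (q j))"
      unfolding F_def sum_distrib_right by (rule sum.swap)
    also have "0 \<le> \<dots>"
    proof (rule sum_nonneg)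
      fix j assume "j \<in> {..<n}"
      then show "0 \<le> (\<Sum>i\<in>P. M i j) * real (q j)" using col[OF P, of j] by simp
    qed
    finally have "\<exists>i\<in>P. 0 \<le> F q i"
      using sum_strict_mono[of P "F q" "\<lambda>_. 0"] cls[OF P] finite_subset[of P "{..<n}"]
      by (force simp: not_le)
    then obtain i where i: "i \<in> P" "0 \<le> F q i" by blast
    then have "q i + 1 = p" using down cls[OF P] by auto
    then have "1/2 \<le> real (q i) / real p" using p by (simp add: field_simps)
    then show "\<exists>i\<in>P. 1/2 \<le> real (q i) / real p" using i by blast
  qed
qed

(* Simultaneous Diophantine approximation turns approximate real weights into exact integer ones:
   after scaling, every slack is an integer larger than -1. *)
lemma complementary_weights:
  fixes M :: "nat \<Rightarrow> nat \<Rightarrow> int"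
  assumes cls: "\<And>P. P \<in> \<P> \<Longrightarrow> P \<noteq> {} \<and> P \<subseteq> {..<n}"
    and col: "\<And>P j. P \<in> \<P> \<Longrightarrow> j < n \<Longrightarrow> 0 \<le> (\<Sum>i\<in>P. M i j)"
  obtains w :: "nat \<Rightarrow> nat"
    where "\<And>i. i < n \<Longrightarrow> 0 < w i \<Longrightarrow> 0 \<le> (\<Sum>j<n. M i j * int (w j))"
      and "\<And>P. P \<in> \<P> \<Longrightarrow> \<exists>i\<in>P. 0 < w i"
proof -
  define L where "L = 1 + (\<Sum>i<n. \<Sum>j<n. nat \<bar>M i j\<bar>)"
  have row: "(\<Sum>j<n. \<bar>real_of_int (M i j)\<bar>) \<le> real L" if "i < n" for i
  proof -
    have "(\<Sum>j<n. nat \<bar>M i j\<bar>) \<le> L"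
      using member_le_sum[of i "{..<n}" "\<lambda>i. \<Sum>j<n. nat \<bar>M i j\<bar>"] that by (auto simp: L_def)
    then have "real (\<Sum>j<n. nat \<bar>M i j\<bar>) \<le> real L" by (simp only: of_nat_le_iff)
    then show ?thesis by simp
  qed
  define N where "N = 2 * L"
  have N: "2 \<le> N" by (simp add: N_def L_def)
  \<comment> \<open>The multiplier \<open>k\<close> will depend on \<open>v\<close>, and
    \<open>v\<close> on \<open>e\<close>. The uniform bound \<open>N ^ n\<close> on \<open>k\<close>
    allows \<open>e\<close> to be fixed first, with scaling costing at most 1/4. Rounding costs at
    most \<open>L / N\<close>, which is 1/2, so the total error stays below 1.\<close>
  define e :: real where "e = 1 / (4 * real (N ^ n))"
  have e: "0 < e" using N by (simp add: e_def)
  obtain v :: "nat \<Rightarrow> real" where v0: "\<And>i. 0 \<le> v i"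
    and v1: "\<And>i. i < n \<Longrightarrow> v i \<noteq> 0 \<Longrightarrow> - e \<le> (\<Sum>j<n. real_of_int (M i j) * v j)"
    and v2: "\<And>P. P \<in> \<P> \<Longrightarrow> \<exists>i\<in>P. 1/2 \<le> v i"
  proof (rule approx_complementary_weights[OF e cls, where M = "\<lambda>i j. real_of_int (M i j)"])
    show "0 \<le> (\<Sum>i\<in>P. real_of_int (M i j))" if "P \<in> \<P>" "j < n" for P j
      using col[OF that] by (simp flip: of_int_sum)
  qed blast+
  obtain k a where k: "0 < k" "k \<le> int (N ^ n)"
    and a: "\<And>i. i < n \<Longrightarrow> \<bar>real_of_int k * v i - real_of_int (a i)\<bar> < 1 / real N"
    using Dirichlet_approx_simult[of N n v] N by auto
  have half: "1 / real N \<le> 1/2" using N by (simp add: field_simps)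
  have k1: "1 \<le> real_of_int k" using k by simp
  have ke: "real_of_int k * e \<le> 1/4"
  proof -
    have "real_of_int k \<le> real (N ^ n)" using k(2) by (metis of_int_le_iff of_int_of_nat_eq)
    then show ?thesis using N by (simp add: e_def field_simps)
  qed
  have a0: "0 \<le> a i" if "i < n" for i
  proof -
    have "0 \<le> real_of_int k * v i" using k1 v0[of i] by simp
    then have "- 1 < real_of_int (a i)" using a[OF that] half by linarith
    then show ?thesis by linarith
  qed
  show thesis
  proof (rule that[of "\<lambda>i. nat (a i)"])
    fix i assume i: "i < n" "0 < nat (a i)"
    \<comment> \<open>A zero weight rounds to zero, so rounding does not enlarge the support and the
      approximate slack bound applies.\<close>
    have "v i \<noteq> 0"
    proof
      assume "v i = 0"
      then have "\<bar>real_of_int (a i)\<bar> < 1" using a[OF i(1)] half by simp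
      then show False using i by linarith
    qed
    then have "- e \<le> (\<Sum>j<n. real_of_int (M i j) * v j)" using v1 i by blast
    then have "real_of_int k * (- e) \<le> real_of_int k * (\<Sum>j<n. real_of_int (M i j) * v j)"
      using k1 by (intro mult_left_mono) auto
    then have 1: "- 1/4 \<le> (\<Sum>j<n. real_of_int (M i j) * (real_of_int k * v j))"
      using ke by (simp add: sum_distrib_left mult.left_commute)
    have "(\<Sum>j<n. real_of_int (M i j) * (real_of_int k * v j)) - (\<Sum>j<n. real_of_int (M i j) * real_of_int (a j))
        = (\<Sum>j<n. real_of_int (M i j) * (real_of_int k * v j - real_of_int (a j)))"
      by (simp add: sum_subtractf right_diff_distrib)
    also have "\<dots> \<le> (\<Sum>j<n. \<bar>real_of_int (M i j)\<bar> * (1 / real N))"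
    proof (rule sum_mono)
      fix j assume "j \<in> {..<n}"
      have "real_of_int (M i j) * (real_of_int k * v j - real_of_int (a j))
          \<le> \<bar>real_of_int (M i j)\<bar> * \<bar>real_of_int k * v j - real_of_int (a j)\<bar>"
        by (metis abs_ge_self abs_mult)
      also have "\<dots> \<le> \<bar>real_of_int (M i j)\<bar> * (1 / real N)"
        using a[of j] \<open>j \<in> {..<n}\<close> by (intro mult_left_mono) auto
      finally show "real_of_int (M i j) * (real_of_int k * v j - real_of_int (a j))
          \<le> \<bar>real_of_int (M i j)\<bar> * (1 / real N)" .
    qed
    also have "\<dots> = (\<Sum>j<n. \<bar>real_of_int (M i j)\<bar>) * (1 / real N)" by (simp only: sum_distrib_right)
    also have "\<dots> \<le> real L * (1 / real N)" using row[OF i(1)] by (rule mult_right_mono) simp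
    also have "\<dots> = 1/2" using N by (simp add: N_def)
    finally have "- 1 < (\<Sum>j<n. real_of_int (M i j) * real_of_int (a j))" using 1 by linarith
    then have "- 1 < real_of_int (\<Sum>j<n. M i j * a j)" by simp
    then have "0 \<le> (\<Sum>j<n. M i j * a j)" by linarith
    also have "\<dots> = (\<Sum>j<n. M i j * int (nat (a j)))" using a0 by (intro sum.cong) auto
    finally show "0 \<le> (\<Sum>j<n. M i j * int (nat (a j)))" .
  next
    fix P assume P: "P \<in> \<P>"
    then obtain i where i: "i \<in> P" "1/2 \<le> v i" using v2 by blast
    then have "i < n" using cls[OF P] by auto
    \<comment> \<open>The rounding error is strictly below 1/2, so a scaled weight of at least 1/2
      cannot round to 0.\<close>
    have "1/2 \<le> real_of_int k * v i" using mult_mono[OF k1 i(2)] k1 by simp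
    then have "0 < real_of_int (a i)" using a[OF \<open>i < n\<close>] half by linarith
    then show "\<exists>i\<in>P. 0 < nat (a i)" using i by auto
  qed
qed

section \<open>Blow-ups and vertices at distance two\<close>

text \<open>Weight 0 deletes a vertex. Copies of one vertex are pairwise nonadjacent when
  \<open>G\<close> has no loops.\<close>

definition blow_up :: "'a pair_pre_digraph \<Rightarrow> ('a \<Rightarrow> nat) \<Rightarrow> ('a \<times> nat) pair_pre_digraph" where
  "blow_up G w = \<lparr>pverts = (SIGMA v:pverts G. {..<w v}),
     parcs = {((u, i), (v, j)) | u i v j. (u, v) \<in> parcs G \<and> i < w u \<and> j < w v}\<rparr>"

lemma arc_blow_up:
  "((u, i), (v, j)) \<in> parcs (blow_up G w) \<longleftrightarrow> (u, v) \<in> parcs G \<and> i < w u \<and> j < w v"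
  by (simp add: blow_up_def)

lemma pair_graph_blow_up:
  assumes "pair_graph G"
  shows "pair_graph (blow_up G w)"
proof -
  interpret pair_graph G by fact
  have symm: "(u, v) \<in> parcs G \<Longrightarrow> (v, u) \<in> parcs G" for u v
    using arcs_ends_symmetric[OF pair_sym_arcs, of u v] by simp
  have noloop: "(u, u) \<notin> parcs G" for u using pair_no_loops by force
  have fin: "finite (pverts (blow_up G w))" by (simp add: blow_up_def pair_finite_verts)
  have ends: "fst e \<in> pverts (blow_up G w)" "snd e \<in> pverts (blow_up G w)"
    if "e \<in> parcs (blow_up G w)" for e
    using that in_arcsD1 in_arcsD2 by (auto simp: blow_up_def)
  have "parcs (blow_up G w) \<subseteq> pverts (blow_up G w) \<times> pverts (blow_up G w)"
    using ends by (metis mem_Times_iff subsetI)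
  then have fina: "finite (parcs (blow_up G w))" using fin by (meson finite_SigmaI finite_subset)
  have "sym (parcs (blow_up G w))"
    by (rule symI) (use symm in \<open>auto simp: blow_up_def\<close>)
  then have "symmetric (with_proj (blow_up G w))" by (simp add: symmetric_def)
  moreover have "fst e \<noteq> snd e" if "e \<in> parcs (blow_up G w)" for e
    using that noloop by (auto simp: blow_up_def)
  ultimately show ?thesis
    using fin fina ends by unfold_locales auto
qed

lemma card_SIGMA_lessThan:
  "finite S \<Longrightarrow> card (SIGMA v:S. {..<w v :: nat}) = sum w S"
  by (simp add: card_SigmaI)

text \<open>Stability of \<open>A\<close> and \<open>C\<close> forces the middle vertex of a
  two-step walk between them into \<open>B\<close>. This replaces distance by a condition that
  treats \<open>A\<close> and \<open>C\<close> alike, for use in both the graph and its reversed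
  blow-up.\<close>

lemma second_neighbours_across:
  assumes G: "pair_graph G" and c: "constrained x y G A B C" and "a \<in> A" "c \<in> C"
  shows "a \<in> second_neighbours G c \<longleftrightarrow> (\<exists>b\<in>B. (a, b) \<in> parcs G \<and> (b, c) \<in> parcs G)"
proof -
  interpret pair_graph G by fact
  have symm: "(u, v) \<in> parcs G \<longleftrightarrow> (v, u) \<in> parcs G" for u v
    using arcs_ends_symmetric[OF pair_sym_arcs, of u v] arcs_ends_symmetric[OF pair_sym_arcs, of v u] by auto
  have tri: "A \<union> B \<union> C = pverts G" "A \<inter> C = {}" "stable G A" "stable G C"
    and nac: "(a, c) \<notin> parcs G"
    using c assms(3,4) by (auto simp: constrained_def tripartition_def)
  have mid: "w \<in> B" if "(a, w) \<in> parcs G" "(w, c) \<in> parcs G" for w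
  proof -
    have "w \<in> A \<union> B \<union> C" using tri(1) in_arcsD2[OF that(1)] by blast
    moreover have "w \<notin> A" "w \<notin> C" using that tri assms(3,4) unfolding stable_def by blast+
    ultimately show ?thesis by blast
  qed
  have in_G: "a \<in> pverts G" "c \<in> pverts G" "a \<noteq> c" using tri assms(3,4) by auto
  show "a \<in> second_neighbours G c \<longleftrightarrow> (\<exists>b\<in>B. (a, b) \<in> parcs G \<and> (b, c) \<in> parcs G)"
    using mid nac in_G symm unfolding second_neighbours_iff[OF G in_G(2)] by metis
qed

section \<open>Reversing the tripartition\<close>

text \<open>The three games are blocks of one matrix, with rows against columns in cyclic order:
  \<open>B\<close> against \<open>A\<close>, \<open>C\<close> against \<open>B\<close>,
  \<open>A\<close> against \<open>C\<close>. The counting hypotheses say that its column sums over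
  each row class are nonnegative, which is what \<open>complementary_weights\<close> asks
  for.\<close>

lemma reversing_weights:
  fixes R :: "nat \<Rightarrow> nat \<Rightarrow> bool" and k l m :: int
  assumes fin: "finite A" "finite B" "finite C"
    and ne: "A \<noteq> {}" "B \<noteq> {}" "C \<noteq> {}"
    and disj: "A \<inter> B = {}" "A \<inter> C = {}" "B \<inter> C = {}"
    and k: "\<And>a. a \<in> A \<Longrightarrow> k \<le> int (card {b\<in>B. R b a})"
    and l: "\<And>b. b \<in> B \<Longrightarrow> l \<le> int (card {c\<in>C. R c b})"
    and m: "\<And>c. c \<in> C \<Longrightarrow> m \<le> int (card {a\<in>A. R a c})"
  obtains w :: "nat \<Rightarrow> nat"
    where "0 < sum w A" "0 < sum w B" "0 < sum w C"
      and "\<And>b. b \<in> B \<Longrightarrow> 0 < w b \<Longrightarrow> k * int (sum w A) \<le> int (card B) * int (sum w {a\<in>A. R b a})"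
      and "\<And>c. c \<in> C \<Longrightarrow> 0 < w c \<Longrightarrow> l * int (sum w B) \<le> int (card C) * int (sum w {b\<in>B. R c b})"
      and "\<And>a. a \<in> A \<Longrightarrow> 0 < w a \<Longrightarrow> m * int (sum w C) \<le> int (card A) * int (sum w {c\<in>C. R a c})"
proof -
  obtain n where n: "A \<union> B \<union> C \<subseteq> {..<n}"
    using fin finite_nat_iff_bounded[of "A \<union> B \<union> C"] by auto
  \<comment> \<open>The row class is \<open>P\<close> and the target fraction is
    \<open>t / card P\<close>. Multiplying through by \<open>card P\<close> keeps the entries
    integral.\<close>
  define T where "T = (\<lambda>(P :: nat set) t i j. int (card P) * of_bool (R i j) - t)"
  \<comment> \<open>Each column meets at most one row class in a nonzero block, so its sum over any
    other class is 0.\<close>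
  define M where "M = (\<lambda>i j. if i \<in> B \<and> j \<in> A then T B k i j
      else if i \<in> C \<and> j \<in> B then T C l i j
      else if i \<in> A \<and> j \<in> C then T A m i j else 0)"
  have col: "0 \<le> (\<Sum>i\<in>P. T P t i j)"
    if "finite P" "t \<le> int (card {i\<in>P. R i j})" for P t j
  proof -
    have "(\<Sum>i\<in>P. T P t i j) = int (card P) * (int (card {i\<in>P. R i j}) - t)"
      using that(1) by (simp add: T_def sum_subtractf algebra_simps Int_def flip: sum_distrib_left)
    then show ?thesis using that(2) by simp
  qed
  have row: "(\<Sum>j<n. (if j \<in> Q then T P t i j else 0) * int (w j))
      = int (card P) * int (sum w {j\<in>Q. R i j}) - t * int (sum w Q)"
    if "Q \<subseteq> {..<n}" for P Q t i and w :: "nat \<Rightarrow> nat"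
  proof -
    have fQ: "finite Q" using that finite_subset by blast
    have "(\<Sum>j<n. (if j \<in> Q then T P t i j else 0) * int (w j)) = (\<Sum>j\<in>Q. T P t i j * int (w j))"
      using that by (intro sum.mono_neutral_cong_right) auto
    also have "\<dots> = int (card P) * (\<Sum>j\<in>Q. if R i j then int (w j) else 0) - t * (\<Sum>j\<in>Q. int (w j))"
      unfolding T_def by (auto simp: sum_distrib_left left_diff_distrib sum_subtractf intro!: sum.cong)
    also have "(\<Sum>j\<in>Q. if R i j then int (w j) else 0) = int (sum w {j\<in>Q. R i j})"
      using fQ by (auto simp: sum.inter_filter intro!: sum.cong)
    finally show ?thesis by simp
  qed
  obtain w :: "nat \<Rightarrow> nat"
    where w: "\<And>i. i < n \<Longrightarrow> 0 < w i \<Longrightarrow> 0 \<le> (\<Sum>j<n. M i j * int (w j))"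
      and pos: "\<And>P. P \<in> {A, B, C} \<Longrightarrow> \<exists>i\<in>P. 0 < w i"
  proof (rule complementary_weights[of "{A, B, C}" n M])
    show "P \<noteq> {} \<and> P \<subseteq> {..<n}" if "P \<in> {A, B, C}" for P using that ne n by auto
    show "0 \<le> (\<Sum>i\<in>P. M i j)" if "P \<in> {A, B, C}" for P j
    proof -
      from that have "P = A \<or> P = B \<or> P = C" by blast
      then consider "P = A" | "P = B" | "P = C" by blast
      then show ?thesis
      proof cases
        case 1
        have "(\<Sum>i\<in>A. M i j) = (if j \<in> C then \<Sum>i\<in>A. T A m i j else 0)"
          using disj by (auto simp: M_def intro!: sum.cong sum.neutral)
        then show ?thesis using 1 col[OF fin(1) m] by simp
      next
        case 2
        have "(\<Sum>i\<in>B. M i j) = (if j \<in> A then \<Sum>i\<in>B. T B k i j else 0)"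
          using disj by (auto simp: M_def intro!: sum.cong sum.neutral)
        then show ?thesis using 2 col[OF fin(2) k] by simp
      next
        case 3
        have "(\<Sum>i\<in>C. M i j) = (if j \<in> B then \<Sum>i\<in>C. T C l i j else 0)"
          using disj by (auto simp: M_def intro!: sum.cong sum.neutral)
        then show ?thesis using 3 col[OF fin(3) l] by simp
      qed
    qed
  qed blast+
  have sum_pos: "0 < sum w P" if "P \<in> {A, B, C}" for P
    using pos[OF that] that fin by (auto simp: sum_pos2)
  show thesis
  proof (rule that[of w])
    show "0 < sum w A" "0 < sum w B" "0 < sum w C" using sum_pos by blast+
    show "k * int (sum w A) \<le> int (card B) * int (sum w {a\<in>A. R b a})" if "b \<in> B" "0 < w b" for b
    proof -
      have "M b = (\<lambda>j. if j \<in> A then T B k b j else 0)" using that disj by (auto simp: M_def fun_eq_iff)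
      then show ?thesis using w[of b] row[of A B k b w] n that by auto
    qed
    show "l * int (sum w B) \<le> int (card C) * int (sum w {b\<in>B. R c b})" if "c \<in> C" "0 < w c" for c
    proof -
      have "M c = (\<lambda>j. if j \<in> B then T C l c j else 0)" using that disj by (auto simp: M_def fun_eq_iff)
      then show ?thesis using w[of c] row[of B C l c w] n that by auto
    qed
    show "m * int (sum w C) \<le> int (card A) * int (sum w {c\<in>C. R a c})" if "a \<in> A" "0 < w a" for a
    proof -
      have "M a = (\<lambda>j. if j \<in> C then T A m a j else 0)" using that disj by (auto simp: M_def fun_eq_iff)
      then show ?thesis using w[of a] row[of C A m a w] n that by auto
    qed
  qed
qed

text \<open>If the fraction \<open>z\<close> failed for \<open>(A, B, C)\<close>, the blow-up by
  reversing weights would violate admissibility of \<open>z\<close> for the exchanged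
  parameters.\<close>

lemma reaches_fraction_of_reversed:
  fixes G :: "nat pair_pre_digraph"
  assumes G: "pair_graph G" and c: "constrained x y G A B C" and adm: "admissible y x z"
  shows "reaches_fraction z G A C"
proof (rule ccontr)
  interpret pair_graph G by fact
  assume n: "\<not> reaches_fraction z G A C"
  have tri: "tripartition G A B C" using c by (simp add: constrained_def)
  have un: "A \<union> B \<union> C = pverts G" and ne: "A \<noteq> {}" "B \<noteq> {}" "C \<noteq> {}"
    and disj: "A \<inter> B = {}" "A \<inter> C = {}" "B \<inter> C = {}"
    and st: "stable G A" "stable G B" "stable G C" using tri by (auto simp: tripartition_def)
  have fin: "finite A" "finite B" "finite C"
    using un pair_finite_verts by (metis finite_Un)+
  have symm: "(u, v) \<in> parcs G \<longleftrightarrow> (v, u) \<in> parcs G" for u v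
    using arcs_ends_symmetric[OF pair_sym_arcs, of u v] arcs_ends_symmetric[OF pair_sym_arcs, of v u] by auto
  have cB: "0 < real (card B)" and cC: "0 < real (card C)"
    using fin ne by (auto simp: card_gt_0_iff)
  define S where "S = (\<lambda>a v. \<exists>b\<in>B. (a, b) \<in> parcs G \<and> (b, v) \<in> parcs G)"
  \<comment> \<open>Taking the complement between \<open>A\<close> and \<open>C\<close> makes all three conditions lower bounds.\<close>
  define R where "R = (\<lambda>i j. if i \<in> A \<and> j \<in> C then \<not> S i j else (i, j) \<in> parcs G)"
  \<comment> \<open>The largest integer strictly below \<open>z * card A\<close>: having fewer than
    \<open>z * card A\<close> second neighbours means having at most \<open>m\<close>.\<close>
  define m where "m = \<lceil>z * real (card A)\<rceil> - 1"
  have RBA: "{b\<in>B. R b a} = neighbours G a \<inter> B" if "a \<in> A" for a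
    using that disj symm by (auto simp: R_def neighbours_def)
  have RCB: "{v\<in>C. R v b} = neighbours G b \<inter> C" if "b \<in> B" for b
    using that disj symm by (auto simp: R_def neighbours_def)
  have RAC: "int (card A) - m \<le> int (card {a\<in>A. R a v})" if "v \<in> C" for v
  proof -
    have "real (card (second_neighbours G v \<inter> A)) < z * real (card A)"
      using n that by (auto simp: reaches_fraction_def not_le)
    then have "int (card (second_neighbours G v \<inter> A)) \<le> m"
      unfolding m_def using less_ceiling_iff[of "int (card (second_neighbours G v \<inter> A))" "z * real (card A)"] by simp
    moreover have "{a\<in>A. R a v} = A - (second_neighbours G v \<inter> A)"
      using second_neighbours_across[OF G c _ that] that by (auto simp: R_def S_def)
    then have "card {a\<in>A. R a v} + card (second_neighbours G v \<inter> A) = card A"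
      using fin(1) by (simp add: card_Diff_subset card_mono)
    ultimately show ?thesis by linarith
  qed
  obtain w :: "nat \<Rightarrow> nat"
    where pos: "0 < sum w A" "0 < sum w B" "0 < sum w C"
      and wB: "\<And>b. b \<in> B \<Longrightarrow> 0 < w b \<Longrightarrow>
        \<lceil>x * real (card B)\<rceil> * int (sum w A) \<le> int (card B) * int (sum w {a\<in>A. R b a})"
      and wC: "\<And>v. v \<in> C \<Longrightarrow> 0 < w v \<Longrightarrow>
        \<lceil>y * real (card C)\<rceil> * int (sum w B) \<le> int (card C) * int (sum w {b\<in>B. R v b})"
      and wA: "\<And>a. a \<in> A \<Longrightarrow> 0 < w a \<Longrightarrow>
        (int (card A) - m) * int (sum w C) \<le> int (card A) * int (sum w {v\<in>C. R a v})"
  proof (rule reversing_weights[OF fin ne disj, of "\<lceil>x * real (card B)\<rceil>" R "\<lceil>y * real (card C)\<rceil>" "int (card A) - m"])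
    show "\<lceil>x * real (card B)\<rceil> \<le> int (card {b\<in>B. R b a})" if "a \<in> A" for a
      using c that RBA[OF that] by (simp add: constrained_def ceiling_le_iff)
    show "\<lceil>y * real (card C)\<rceil> \<le> int (card {v\<in>C. R v b})" if "b \<in> B" for b
      using c that RCB[OF that] by (simp add: constrained_def ceiling_le_iff)
  qed (use RAC in blast)+
  define H where "H = blow_up G w"
  define lift where "lift = (\<lambda>P. SIGMA v:P. {..<w v})"
  have H: "pair_graph H" unfolding H_def by (rule pair_graph_blow_up[OF G])
  have card_lift: "card (lift P) = sum w P" if "finite P" for P
    using that by (simp add: lift_def card_SIGMA_lessThan)
  have lift_ne: "lift P \<noteq> {}" if "0 < sum w P" "finite P" for P
    using card_lift[OF that(2)] that(1) by force
  have st_lift: "stable H (lift P)" if "stable G P" for P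
    using that by (auto simp: stable_def H_def lift_def arc_blow_up) (auto simp: blow_up_def)
  have nb: "neighbours H (v, i) \<inter> lift P = lift {u\<in>P. (v, u) \<in> parcs G}" if "i < w v" for v i P
    using that by (auto simp: neighbours_def H_def lift_def arc_blow_up)
  \<comment> \<open>Rounding the targets up made them integers; this returns to real fractions by
    cancelling \<open>card P\<close>.\<close>
  have scale: "t * real s \<le> real r"
    if "\<lceil>t * real (card P)\<rceil> * int s \<le> int (card P) * int r" "0 < real (card P)" for t s r and P :: "nat set"
  proof -
    have "t * real (card P) * real s \<le> real_of_int \<lceil>t * real (card P)\<rceil> * real s"
      by (intro mult_right_mono) auto
    also have "\<dots> \<le> real (card P) * real r" using that(1)
      by (metis of_int_le_iff of_int_mult of_int_of_nat_eq)
    finally show ?thesis using that(2) by (simp add: mult.commute mult.left_commute)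
  qed
  \<comment> \<open>Every vertex of \<open>H\<close> is a copy of a vertex of positive weight, so
    \<open>wB\<close> and \<open>wC\<close>, which assume positive weight, cover all of
    them.\<close>
  have cH: "constrained y x H (lift C) (lift B) (lift A)"
    unfolding constrained_def
  proof (intro conjI ballI)
    show "tripartition H (lift C) (lift B) (lift A)"
      unfolding tripartition_def using st_lift st disj un lift_ne pos fin
      by (auto simp: H_def blow_up_def lift_def)
    show "y * real (card (lift B)) \<le> real (card (neighbours H v \<inter> lift B))" if v: "v \<in> lift C" for v
    proof -
      obtain u i where u: "v = (u, i)" "u \<in> C" "i < w u" using v by (auto simp: lift_def)
      have "{b\<in>B. R u b} = {b\<in>B. (u, b) \<in> parcs G}" using u disj by (auto simp: R_def)
      then show ?thesis using scale[OF wC[OF u(2)] cC] u nb fin by (simp add: card_lift)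
    qed
    show "x * real (card (lift A)) \<le> real (card (neighbours H v \<inter> lift A))" if v: "v \<in> lift B" for v
    proof -
      obtain u i where u: "v = (u, i)" "u \<in> B" "i < w u" using v by (auto simp: lift_def)
      have "{a\<in>A. R u a} = {a\<in>A. (u, a) \<in> parcs G}" using u disj by (auto simp: R_def)
      then show ?thesis using scale[OF wB[OF u(2)] cB] u nb fin by (simp add: card_lift)
    qed
    show "(v, u) \<notin> parcs H" if "v \<in> lift C" "u \<in> lift A" for v u
    proof -
      have "(fst u, fst v) \<notin> parcs G" using c that by (auto simp: constrained_def lift_def)
      then show ?thesis using symm by (cases u; cases v) (auto simp: H_def arc_blow_up)
    qed
  qed
  \<comment> \<open>Admissibility speaks of graphs on \<open>nat\<close>, while the vertices of
    \<open>H\<close> are pairs; hence the transfer by \<open>admissible_any\<close>.\<close>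
  obtain v where v: "v \<in> lift A"
    and zv: "z * real (card (lift C)) \<le> real (card (second_neighbours H v \<inter> lift C))"
    using admissible_any[OF adm H cH] by (auto simp: reaches_fraction_def)
  obtain a i where a: "v = (a, i)" "a \<in> A" "i < w a" using v by (auto simp: lift_def)
  \<comment> \<open>Two-step walks in \<open>H\<close> project to two-step walks in
    \<open>G\<close>, which bounds the second neighbourhood from above.\<close>
  have "second_neighbours H v \<inter> lift C \<subseteq> lift {u\<in>C. S a u}"
  proof
    fix u assume u: "u \<in> second_neighbours H v \<inter> lift C"
    then have "\<exists>b\<in>lift B. (u, b) \<in> parcs H \<and> (b, v) \<in> parcs H"
      using second_neighbours_across[OF H cH _ v] by blast
    then show "u \<in> lift {u\<in>C. S a u}"
      using u a symm by (auto simp: H_def lift_def S_def arc_blow_up)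
  qed
  then have "card (second_neighbours H v \<inter> lift C) \<le> card (lift {u\<in>C. S a u})"
    using fin by (intro card_mono) (auto simp: lift_def)
  then have "real (card (second_neighbours H v \<inter> lift C)) \<le> real (sum w {u\<in>C. S a u})"
    using fin by (simp add: card_lift del: of_nat_sum)
  with zv have 1: "z * real (sum w C) \<le> real (sum w {u\<in>C. S a u})"
    using card_lift[OF fin(3)] by simp
  have "{u\<in>C. R a u} = {u\<in>C. \<not> S a u}" using a by (auto simp: R_def)
  moreover have "int (sum w C) = int (sum w {u\<in>C. S a u}) + int (sum w {u\<in>C. \<not> S a u})"
  proof -
    have "sum w C = sum w ({u\<in>C. S a u} \<union> {u\<in>C. \<not> S a u})" by (rule sum.cong) auto
    also have "\<dots> = sum w {u\<in>C. S a u} + sum w {u\<in>C. \<not> S a u}"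
      using fin(3) by (intro sum.union_disjoint) auto
    finally show ?thesis by (simp only: of_nat_add)
  qed
  moreover have "(int (card A) - m) * int (sum w C) \<le> int (card A) * int (sum w {u\<in>C. R a u})"
    using wA a by simp
  \<comment> \<open>This undoes the complement: of the weight on \<open>C\<close>, the vertex
    \<open>a\<close> reaches at most the fraction \<open>m / card A\<close>. That is strictly less
    than \<open>z\<close>, contradicting the choice of \<open>v\<close>.\<close>
  ultimately have "int (card A) * int (sum w {u\<in>C. S a u}) \<le> m * int (sum w C)"
    by (simp only: left_diff_distrib distrib_left)
  then have "real_of_int (int (card A) * int (sum w {u\<in>C. S a u})) \<le> real_of_int (m * int (sum w C))"
    by (simp only: of_int_le_iff)
  then have "real (card A) * real (sum w {u\<in>C. S a u}) \<le> real_of_int m * real (sum w C)"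
    by (simp only: of_int_mult of_int_of_nat_eq)
  also have "\<dots> < z * real (card A) * real (sum w C)"
  proof (rule mult_strict_right_mono)
    show "real_of_int m < z * real (card A)" unfolding m_def by linarith
    show "0 < real (sum w C)" using pos(3) by (simp only: of_nat_0_less_iff)
  qed
  also have "\<dots> = real (card A) * (z * real (sum w C))" by (simp only: mult_ac)
  also have "\<dots> \<le> real (card A) * real (sum w {u\<in>C. S a u})"
    by (rule mult_left_mono[OF 1]) simp
  finally show False by simp
qed

theorem mainTheorem1:
  fixes x y :: real
  assumes "x \<in> {0<..1}" and "y \<in> {0<..1}"
  shows "phi x y = phi y x"
proof -
  \<comment> \<open>The bound is proved for arbitrary parameters, so exchanging them gives the
    opposite inequality.\<close>
  have "phi y x \<le> phi x y" if "x \<in> {0<..1}" "y \<in> {0<..1}" for x y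
  proof (rule phi_props(3)[OF that])
    show "phi y x \<in> {0<..1}" by (rule phi_props(1)[OF that(2,1)])
    show "admissible x y (phi y x)"
      unfolding admissible_def[of x y]
      using reaches_fraction_of_reversed[OF _ _ phi_props(2)[OF that(2,1)]] by blast
  qed
  then show ?thesis using assms by (simp add: order_antisym)
qed

end
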